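(* Every $2$-coloring of the edges of $K_{\mathbb{N}}$ contains a monochromatic connected subgraph $T$ with $\bar{d}_s(T)=1$.
   Context: $K_{\mathbb{N}}$ is the complete graph on the positive integers $\mathbb{N}$; a $2$-coloring is a partition of its edges into two color classes, and a monochromatic subgraph is one all of whose edges have the same color. For an infinite sequence $A=(a_1,a_2,\dots)$ of distinct positive integers, let $f(n)=\sup\{m:\{a_1,\dots,a_m\}\subseteq\{1,\dots,n\}\}$ and $\bar{d}_s(A)=\limsup_{n\to\infty}f(n)/n$. For a connected subgraph $T$ of $K_{\mathbb{N}}$, its strong upper density is $\bar{d}_s(T)=\sup_{V\in\pi}\bar{d}_s(V)$, where $\pi$ is the set of all orderings $(v_1,v_2,\dots)$ of $V(T)$ such that for every $k\geq 1$ the subgraph of $T$ induced by $\{v_1,\dots,v_k\}$ is connected. *)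

theory Defs
  imports Complex_Main "HOL-Library.Extended_Real"
begin

record 'a ugraph =
  verts :: "'a set"
  edges :: "'a set set"

definition simple_graph :: "'a ugraph \<Rightarrow> bool" where
  "simple_graph G \<longleftrightarrow>
     (\<forall>e \<in> edges G. \<exists>u \<in> verts G. \<exists>v \<in> verts G. u \<noteq> v \<and> e = {u, v})"

definition subgraph :: "'a ugraph \<Rightarrow> 'a ugraph \<Rightarrow> bool" where
  "subgraph H G \<longleftrightarrow> simple_graph H \<and> verts H \<subseteq> verts G \<and> edges H \<subseteq> edges G"

definition induced_subgraph :: "'a ugraph \<Rightarrow> 'a set \<Rightarrow> 'a ugraph" where
  "induced_subgraph G S =
     \<lparr>verts = verts G \<inter> S, edges = {e \<in> edges G. e \<subseteq> S}\<rparr>"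

definition adj :: "'a ugraph \<Rightarrow> ('a \<times> 'a) set" where
  "adj G = {(u, v). {u, v} \<in> edges G}"

definition connected_graph :: "'a ugraph \<Rightarrow> bool" where
  "connected_graph G \<longleftrightarrow>
     verts G \<noteq> {} \<and> (\<forall>u \<in> verts G. \<forall>v \<in> verts G. (u, v) \<in> (adj G)\<^sup>*)"

definition complete_graph :: "'a set \<Rightarrow> 'a ugraph" where
  "complete_graph S =
     \<lparr>verts = S, edges = {{u, v} | u v. u \<in> S \<and> v \<in> S \<and> u \<noteq> v}\<rparr>"

definition K_nat :: "nat ugraph" where
  "K_nat = complete_graph {1..}"

definition two_coloring :: "'a ugraph \<Rightarrow> 'a set set \<Rightarrow> 'a set set \<Rightarrow> bool" where
  "two_coloring G R B \<longleftrightarrow> R \<union> B = edges G \<and> R \<inter> B = {}"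

definition monochromatic :: "'a set set \<Rightarrow> 'a set set \<Rightarrow> 'a ugraph \<Rightarrow> bool" where
  "monochromatic R B H \<longleftrightarrow> edges H \<subseteq> R \<or> edges H \<subseteq> B"

text \<open>
  A sequence \<open>(a\<^sub>1, a\<^sub>2, \<dots>)\<close> is a function on \<open>nat\<close> whose value at \<open>0\<close> is never used.
  The set below contains \<open>0\<close>, and it is finite when the \<open>a\<^sub>i\<close> are distinct, so that
  \<open>Sup\<close> on \<open>nat\<close> is its maximum.
\<close>

definition initial_count :: "(nat \<Rightarrow> nat) \<Rightarrow> nat \<Rightarrow> nat" where
  "initial_count a n = Sup {m. a ` {1..m} \<subseteq> {1..n}}"

definition seq_strong_upper_density :: "(nat \<Rightarrow> nat) \<Rightarrow> ereal" where
  "seq_strong_upper_density a = limsup (\<lambda>n. ereal (real (initial_count a n) / real n))"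

definition connected_orderings :: "nat ugraph \<Rightarrow> (nat \<Rightarrow> nat) set" where
  "connected_orderings T =
     {v. bij_betw v {1..} (verts T) \<and>
         (\<forall>k \<ge> 1. connected_graph (induced_subgraph T (v ` {1..k})))}"

text \<open>
  A finite \<open>T\<close> has no infinite ordering of its vertices; its density is then
  \<open>Sup {} = -\<infinity>\<close> in \<open>ereal\<close>.
\<close>

definition strong_upper_density :: "nat ugraph \<Rightarrow> ereal" where
  "strong_upper_density T = (SUP v \<in> connected_orderings T. seq_strong_upper_density v)"

end

theory Submission
  imports Defs
begin

text \<open>
  For every \<open>n \<ge> 1\<close> one of the two colors is connected on \<open>{1..n}\<close>, since the complement of
  a disconnected graph is connected. Hence one color, say red, is connected on \<open>{1..n}\<close> for
  infinitely many \<open>n\<close>. Let \<open>T\<close> be the spanning red graph, and order its vertices greedily: always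
  append a vertex that is red-adjacent to the current ones, and exhaust each such \<open>{1..n}\<close> before
  leaving it. For all those \<open>n\<close> the ordering then satisfies \<open>f(n) = n\<close>.
\<close>

section \<open>Connectivity of induced subgraphs\<close>

lemma induced_adj_iff:
  "(x, y) \<in> adj (induced_subgraph G S) \<longleftrightarrow> {x, y} \<in> edges G \<and> x \<in> S \<and> y \<in> S"
  by (auto simp: adj_def induced_subgraph_def)

lemma sym_adj: "sym (adj G)"
  by (auto simp: sym_def adj_def insert_commute)

text \<open>If \<open>H\<close> is disconnected on \<open>S\<close>, then \<open>G\<close> joins an
  \<open>H\<close>-component of \<open>S\<close> completely to the rest of \<open>S\<close>, and a
  complete bipartite graph with two nonempty sides is connected.\<close>

lemma connected_induced_union_cases:
  assumes E: "\<And>x y. x \<in> S \<Longrightarrow> y \<in> S \<Longrightarrow> x \<noteq> y \<Longrightarrow> {x, y} \<in> edges G \<union> edges H"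
    and S: "S \<noteq> {}" "S \<subseteq> verts G" "S \<subseteq> verts H"
  shows "connected_graph (induced_subgraph G S) \<or> connected_graph (induced_subgraph H S)"
proof (rule disjCI)
  let ?r = "adj (induced_subgraph G S)" and ?b = "adj (induced_subgraph H S)"
  assume "\<not> connected_graph (induced_subgraph H S)"
  then obtain u w where uw: "u \<in> S" "w \<in> S" "(u, w) \<notin> ?b\<^sup>*"
    using S by (auto simp: connected_graph_def induced_subgraph_def)
  define C where "C = {x. (u, x) \<in> ?b\<^sup>*}"
  have cross: "(x, y) \<in> ?r" "(y, x) \<in> ?r" if "x \<in> S" "y \<in> S" "x \<in> C" "y \<notin> C" for x y
  proof -
    have "(x, y) \<notin> ?b"
      using that by (auto simp: C_def intro: rtrancl_into_rtrancl)
    moreover have "x \<noteq> y"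
      using that by auto
    ultimately show "(x, y) \<in> ?r"
      using E[of x y] that by (auto simp: induced_adj_iff)
    then show "(y, x) \<in> ?r"
      by (rule symD[OF sym_adj])
  qed
  have uC: "u \<in> C" "w \<notin> C"
    using uw by (auto simp: C_def)
  have "(x, y) \<in> ?r\<^sup>*" if "x \<in> S" "y \<in> S" for x y
  proof (cases "x \<in> C \<longleftrightarrow> y \<in> C")
    case True
    \<comment> \<open>For two vertices on the same side of the cut, any vertex of the other side is
      a common neighbour.\<close>
    define z where "z = (if x \<in> C then w else u)"
    have "(x, z) \<in> ?r" "(z, y) \<in> ?r"
      using cross[of x w] cross[of y w] cross[of u x] cross[of u y] uC uw that True
      by (simp_all add: z_def)
    then show ?thesis
      by (meson converse_rtrancl_into_rtrancl r_into_rtrancl)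
  next
    case False
    then have "(x, y) \<in> ?r"
      using cross[of x y] cross[of y x] that by blast
    then show ?thesis ..
  qed
  then show "connected_graph (induced_subgraph G S)"
    using S by (auto simp: connected_graph_def induced_subgraph_def)
qed

text \<open>Every vertex of the enlarged set reaches \<open>y\<close>, and reachability is
  symmetric, so any two vertices are linked through \<open>y\<close>.\<close>

lemma connected_induced_insert:
  assumes conn: "connected_graph (induced_subgraph G S)" and "S \<subseteq> verts G"
    and x: "x \<in> verts G" and y: "y \<in> S" "{x, y} \<in> edges G"
  shows "connected_graph (induced_subgraph G (insert x S))"
proof -
  let ?a = "adj (induced_subgraph G S)" and ?b = "adj (induced_subgraph G (insert x S))"
  have "?a \<subseteq> ?b"
    by (auto simp: induced_adj_iff)
  then have "?a\<^sup>* \<subseteq> ?b\<^sup>*"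
    by (rule rtrancl_mono)
  moreover have "(u, y) \<in> ?a\<^sup>*" if "u \<in> S" for u
    using conn that y assms(2) by (auto simp: connected_graph_def induced_subgraph_def)
  moreover have "(x, y) \<in> ?b\<^sup>*"
    using y by (intro r_into_rtrancl) (simp add: induced_adj_iff)
  ultimately have to_y: "(u, y) \<in> ?b\<^sup>*" if "u \<in> insert x S" for u
    using that by blast
  have "(u, w) \<in> ?b\<^sup>*" if "u \<in> insert x S" "w \<in> insert x S" for u w
    using to_y[OF that(1)] symD[OF sym_rtrancl[OF sym_adj] to_y[OF that(2)]]
    by (rule rtrancl_trans)
  then show ?thesis
    using x by (auto simp: connected_graph_def induced_subgraph_def)
qed

text \<open>Supplies the vertex for a greedy step: a path inside \<open>S'\<close> from
  \<open>S\<close> to a vertex outside \<open>S\<close> has an edge on which it leaves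
  \<open>S\<close>.\<close>

lemma connected_induced_boundary_edge:
  assumes conn: "connected_graph (induced_subgraph G S')" and "S' \<subseteq> verts G"
    and S: "S \<subset> S'" "S \<noteq> {}"
  obtains x y where "x \<in> S' - S" "y \<in> S" "{x, y} \<in> edges G"
proof -
  let ?a = "adj (induced_subgraph G S')"
  obtain u w where uw: "u \<in> S" "w \<in> S'" "w \<notin> S"
    using S by blast
  then have "(u, w) \<in> ?a\<^sup>*"
    using conn assms(2) S by (auto simp: connected_graph_def induced_subgraph_def)
  then have "\<exists>p q. (p, q) \<in> ?a \<and> p \<in> S \<and> q \<notin> S"
    using uw(3)
  proof (induction rule: rtrancl_induct)
    case base
    then show ?case using uw(1) by simp
  next
    case (step p q)
    then show ?case by blast
  qed
  then show thesis
    using that by (auto simp: induced_adj_iff insert_commute)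
qed

section \<open>Greedy orderings that exhaust connected initial segments\<close>

lemma ex_connected_exhaustion:
  fixes G :: "nat ugraph"
  assumes verts: "verts G = {1..}"
    and conn: "\<exists>\<^sub>\<infinity>n. connected_graph (induced_subgraph G {1..n})"
  obtains v where "v \<in> connected_orderings G"
    and "\<And>n. connected_graph (induced_subgraph G {1..n}) \<Longrightarrow> v ` {1..n} = {1..n}"
proof -
  define good where "good n \<longleftrightarrow> connected_graph (induced_subgraph G {1..n})" for n :: nat
  \<comment> \<open>Stage \<open>k\<close> will be confined to \<open>{1..g k}\<close>. Since
    \<open>g n = n\<close> for good \<open>n\<close>, the \<open>n\<close> vertices of stage
    \<open>n\<close> then fill \<open>{1..n}\<close>.\<close>
  define g where "g k = (LEAST n. k \<le> n \<and> good n)" for k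
  have ex: "\<exists>n. k \<le> n \<and> good n" for k
    using conn by (auto simp: INFM_nat_le good_def)
  have g: "k \<le> g k" "good (g k)" for k
    using LeastI_ex[OF ex[of k]] by (auto simp: g_def)
  have g_le: "g k \<le> n" if "k \<le> n" "good n" for k n
    unfolding g_def using that by (intro Least_le) simp
  have g_Suc: "g k \<le> g (Suc k)" for k
    using g[of "Suc k"] by (intro g_le) auto
  \<comment> \<open>The guard \<open>k \<ge> 1\<close> is there because the empty graph does not
    count as connected.\<close>
  define P where "P k S \<longleftrightarrow> S \<subseteq> {1..g k} \<and> card S = k \<and>
      (k \<ge> 1 \<longrightarrow> connected_graph (induced_subgraph G S))" for k S
  have step: "\<exists>S'. P (Suc k) S' \<and> (\<exists>x. x \<notin> S \<and> S' = insert x S)" if "P k S" for k S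
  proof -
    have S: "S \<subseteq> {1..g (Suc k)}" "card S = k" "finite S"
      using that g_Suc[of k] by (auto simp: P_def intro: finite_subset)
    \<comment> \<open>Only \<open>k < g (Suc k)\<close> vertices are placed so far, so there is room
      for another.\<close>
    have "S \<noteq> {1..g (Suc k)}"
    proof
      assume "S = {1..g (Suc k)}"
      then have "card S = g (Suc k)"
        by simp
      then show False
        using S(2) g(1)[of "Suc k"] by linarith
    qed
    with S(1) have proper: "S \<subset> {1..g (Suc k)}"
      by (rule psubsetI)
    have "\<exists>x \<in> {1..g (Suc k)} - S. connected_graph (induced_subgraph G (insert x S))"
    proof (cases "S = {}")
      case True
      \<comment> \<open>A boundary edge exists only for a nonempty set, so the first vertex is
        chosen by hand.\<close>
      have "connected_graph (induced_subgraph G {1})"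
        by (simp add: connected_graph_def induced_subgraph_def verts)
      moreover have "1 \<in> {1..g (Suc k)} - S"
        using True g(1)[of "Suc k"] by auto
      ultimately show ?thesis
        using True by auto
    next
      case False
      obtain x y where xy: "x \<in> {1..g (Suc k)} - S" "y \<in> S" "{x, y} \<in> edges G"
        using connected_induced_boundary_edge[OF g(2)[of "Suc k", unfolded good_def] _ proper False]
        by (auto simp: verts)
      have "k \<ge> 1"
        using False S by (cases k) auto
      then have "connected_graph (induced_subgraph G S)"
        using that by (simp add: P_def)
      then have "connected_graph (induced_subgraph G (insert x S))"
        by (rule connected_induced_insert) (use xy S in \<open>auto simp: verts\<close>)
      then show ?thesis
        using xy by blast
    qed
    then obtain x where "x \<in> {1..g (Suc k)} - S"
      "connected_graph (induced_subgraph G (insert x S))"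
      by blast
    then show ?thesis
      using S by (intro exI[of _ "insert x S"]) (auto simp: P_def)
  qed
  have "P 0 {}"
    by (simp add: P_def)
  then have "\<exists>S. \<forall>k. P k (S k) \<and> (\<exists>x. x \<notin> S k \<and> S (Suc k) = insert x (S k))"
    by (intro dependent_nat_choice step) (rule exI)
  then obtain S where S: "\<And>k. P k (S k)" "\<And>k. \<exists>x. x \<notin> S k \<and> S (Suc k) = insert x (S k)"
    by blast
  \<comment> \<open>The choice above yields only the growing sets; \<open>h k\<close> is the vertex
    that stage \<open>Suc k\<close> adds.\<close>
  obtain h where h: "\<And>k. h k \<notin> S k" "\<And>k. S (Suc k) = insert (h k) (S k)"
    using S(2) by metis
  \<comment> \<open>Orderings start at index 1 whereas \<open>h\<close> starts at 0, hence the
    shift.\<close>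
  define v where "v k = h (k - 1)" for k
  have finS: "finite (S k)" "card (S k) = k" for k
    using S(1)[of k] by (auto simp: P_def intro: finite_subset)
  have vS: "v ` {1..k} = S k" for k
  proof (induction k)
    case 0
    then show ?case using finS[of 0] by simp
  next
    case (Suc k)
    have "{1..Suc k} = insert (Suc k) {1..k}"
      by auto
    then show ?case
      using Suc h(2)[of k] by (simp add: v_def)
  qed
  have fill: "v ` {1..n} = {1..n}" if "good n" for n
  proof -
    have "S n \<subseteq> {1..n}"
      using S(1)[of n] g_le[of n n] that by (fastforce simp: P_def)
    then have "S n = {1..n}"
      using finS[of n] by (intro card_subset_eq) auto
    then show ?thesis
      using vS by simp
  qed
  have "inj_on v {1..}"
  proof (rule linorder_inj_onI')
    fix i j :: nat assume "i \<in> {1..}" "j \<in> {1..}" "i < j"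
    \<comment> \<open>\<open>v i\<close> is already placed at stage \<open>j - 1\<close>, whereas
      \<open>v j\<close> lies outside that stage.\<close>
    then have "v i \<in> v ` {1..j - 1}"
      by (intro imageI) auto
    then show "v i \<noteq> v j"
      using h(1)[of "j - 1"] vS[of "j - 1"] by (auto simp: v_def)
  qed
  moreover have "v ` {1..} = {1..}"
  proof
    show "v ` {1..} \<subseteq> {1..}"
    proof (rule image_subsetI)
      fix k :: nat assume "k \<in> {1..}"
      then have "v k \<in> S k"
        unfolding vS[symmetric] by (intro imageI) auto
      then show "v k \<in> {1..}"
        using S(1)[of k] by (auto simp: P_def)
    qed
    show "{1..} \<subseteq> v ` {1..}"
    proof (rule subsetI)
      fix k :: nat assume "k \<in> {1..}"
      \<comment> \<open>Every \<open>k\<close> lies in the good segment \<open>{1..g k}\<close>,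
        which the ordering fills.\<close>
      then have "k \<in> v ` {1..g k}"
        using fill[OF g(2)[of k]] g(1)[of k] by simp
      then show "k \<in> v ` {1..}"
        by auto
    qed
  qed
  moreover have "connected_graph (induced_subgraph G (v ` {1..k}))" if "k \<ge> 1" for k
    unfolding vS using S(1)[of k] that by (simp add: P_def)
  ultimately have "v \<in> connected_orderings G"
    by (simp add: connected_orderings_def bij_betw_def verts)
  with fill show thesis
    using that by (simp add: good_def)
qed

section \<open>Strong upper density of an ordering\<close>

lemma initial_count_bounded:
  fixes v :: "nat \<Rightarrow> nat"
  assumes "inj_on v {1..}" "v ` {1..m} \<subseteq> {1..n}"
  shows "m \<le> n"
proof -
  have "inj_on v {1..m}"
    using assms(1) by (rule inj_on_subset) auto
  then have "card {1..m} \<le> card {1..n}"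
    using assms(2) by (rule card_inj_on_le) simp
  then show ?thesis
    by simp
qed

lemma initial_count_le:
  assumes "inj_on v {1..}"
  shows "initial_count v n \<le> n"
  unfolding initial_count_def
proof (rule cSup_least)
  show "{m. v ` {1..m} \<subseteq> {1..n}} \<noteq> {}"
    by (auto intro: exI[of _ 0])
qed (blast intro: initial_count_bounded[OF assms])

text \<open>The bound from injectivity is essential: \<open>Sup\<close> on \<open>nat\<close> is
  guaranteed to dominate the members of a set only when the set is bounded.\<close>

lemma initial_count_ge:
  assumes "inj_on v {1..}" "v ` {1..m} \<subseteq> {1..n}"
  shows "m \<le> initial_count v n"
  unfolding initial_count_def
proof (rule cSup_upper)
  show "bdd_above {m. v ` {1..m} \<subseteq> {1..n}}"
    by (rule bdd_aboveI[of _ n]) (blast intro: initial_count_bounded[OF assms(1)])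
qed (use assms(2) in simp)

lemma seq_strong_upper_density_le_1:
  assumes "inj_on v {1..}"
  shows "seq_strong_upper_density v \<le> 1"
  unfolding seq_strong_upper_density_def
  \<comment> \<open>At \<open>n = 0\<close> the quotient is 0, as division by zero gives 0.\<close>
  by (intro Limsup_bounded always_eventually allI)
     (use initial_count_le[OF assms] in \<open>auto simp: divide_le_eq_1 one_ereal_def\<close>)

text \<open>The ratio equals 1 at infinitely many positive \<open>n\<close>, whereas a limsup below
  1 would force it below 1 eventually.\<close>

lemma seq_strong_upper_density_eq_1:
  assumes inj: "inj_on v {1..}" and "\<exists>\<^sub>\<infinity>n. v ` {1..n} = {1..n}"
  shows "seq_strong_upper_density v = 1"
proof (rule antisym)
  show "1 \<le> seq_strong_upper_density v"
  proof (rule ccontr)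
    let ?q = "\<lambda>n. ereal (real (initial_count v n) / real n)"
    assume "\<not> 1 \<le> seq_strong_upper_density v"
    then have "limsup ?q < 1"
      by (simp add: seq_strong_upper_density_def)
    then have "\<forall>\<^sub>F n in sequentially. ?q n < 1"
      by (rule Limsup_lessD)
    then have "\<forall>\<^sub>F n in sequentially. v ` {1..n} \<noteq> {1..n}"
      \<comment> \<open>\<open>n = 0\<close> must be excluded: there the image condition holds, yet
        the ratio is 0.\<close>
      using eventually_gt_at_top[of 0]
    proof eventually_elim
      case (elim n)
      show ?case
      proof
        assume "v ` {1..n} = {1..n}"
        then have "initial_count v n = n"
          using initial_count_le[OF inj, of n] initial_count_ge[OF inj, of n n] by simp
        with elim show False
          by (simp add: one_ereal_def)
      qed
    qed
    then show False
      using assms(2) by (simp add: cofinite_eq_sequentially frequently_def)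
  qed
qed (rule seq_strong_upper_density_le_1[OF inj])

text \<open>The supremum is attained, by the ordering that fills every connected initial
  segment.\<close>

lemma strong_upper_density_eq_1:
  assumes verts: "verts G = {1..}"
    and conn: "\<exists>\<^sub>\<infinity>n. connected_graph (induced_subgraph G {1..n})"
  shows "strong_upper_density G = 1"
  unfolding strong_upper_density_def
proof (rule antisym)
  show "(SUP v \<in> connected_orderings G. seq_strong_upper_density v) \<le> 1"
    by (intro SUP_least seq_strong_upper_density_le_1)
       (auto simp: connected_orderings_def bij_betw_def)
  obtain v where v: "v \<in> connected_orderings G"
    "\<And>n. connected_graph (induced_subgraph G {1..n}) \<Longrightarrow> v ` {1..n} = {1..n}"
    using ex_connected_exhaustion[OF assms] by blast
  have "seq_strong_upper_density v = 1"
  proof (rule seq_strong_upper_density_eq_1)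
    show "inj_on v {1..}"
      using v(1) by (auto simp: connected_orderings_def bij_betw_def)
    show "\<exists>\<^sub>\<infinity>n. v ` {1..n} = {1..n}"
      using conn by (rule frequently_elim1) (rule v(2))
  qed
  then show "1 \<le> (SUP v \<in> connected_orderings G. seq_strong_upper_density v)"
    using SUP_upper[OF v(1), of seq_strong_upper_density] by simp
qed

text \<open>Any two vertices lie in a common connected initial segment, and a path there is a path
  in \<open>G\<close>.\<close>

lemma connected_graph_if_inf_many_initial:
  fixes G :: "nat ugraph"
  assumes verts: "verts G = {1..}"
    and conn: "\<exists>\<^sub>\<infinity>n. connected_graph (induced_subgraph G {1..n})"
  shows "connected_graph G"
  unfolding connected_graph_def
proof (intro conjI ballI)
  show "verts G \<noteq> {}"
    by (simp add: verts)
  fix u w assume uw: "u \<in> verts G" "w \<in> verts G"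
  obtain n where n: "max u w \<le> n" "connected_graph (induced_subgraph G {1..n})"
    using conn unfolding INFM_nat_le by blast
  then have "(u, w) \<in> (adj (induced_subgraph G {1..n}))\<^sup>*"
    using uw by (auto simp: connected_graph_def induced_subgraph_def verts)
  moreover have "adj (induced_subgraph G {1..n}) \<subseteq> adj G"
    by (auto simp: adj_def induced_subgraph_def)
  ultimately show "(u, w) \<in> (adj G)\<^sup>*"
    using rtrancl_mono by blast
qed

theorem theorem1p11:
  fixes R B :: "nat set set"
  assumes "two_coloring K_nat R B"
  shows "\<exists>T. subgraph T K_nat \<and> monochromatic R B T \<and> connected_graph T \<and>
             strong_upper_density T = 1"
proof -
  \<comment> \<open>Keeping all positive integers as vertices, even those without an edge in
    \<open>X\<close>, makes \<open>{1..n}\<close> the exact vertex set of the subgraph induced on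
    it.\<close>
  define G :: "nat set set \<Rightarrow> nat ugraph" where "G X = \<lparr>verts = {1..}, edges = X\<rparr>" for X
  have RB: "R \<union> B = edges K_nat"
    using assms by (simp add: two_coloring_def)
  let ?conn = "\<lambda>X n. connected_graph (induced_subgraph (G X) {1..n})"
  have "?conn R n \<or> ?conn B n" if "n \<ge> 1" for n
  proof (rule connected_induced_union_cases)
    fix x y assume "x \<in> {1..n}" "y \<in> {1..n}" "x \<noteq> y"
    then have "{x, y} \<in> edges K_nat"
      by (auto simp: K_nat_def complete_graph_def)
    then show "{x, y} \<in> edges (G R) \<union> edges (G B)"
      using RB by (simp add: G_def)
  qed (use that in \<open>auto simp: G_def\<close>)
  then have "\<exists>\<^sub>\<infinity>n. ?conn R n \<or> ?conn B n"
    by (intro MOST_INFM MOST_nat[THEN iffD2] exI[of _ 0]) auto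
  \<comment> \<open>Pigeonhole: one of the two colors occurs for infinitely many
    \<open>n\<close>.\<close>
  then obtain X where X: "X \<in> {R, B}" "\<exists>\<^sub>\<infinity>n. ?conn X n"
    by (auto simp: INFM_disj_distrib)
  have "simple_graph (G X)"
    unfolding simple_graph_def
  proof
    fix e assume "e \<in> edges (G X)"
    then have "e \<in> edges K_nat"
      using X(1) RB by (auto simp: G_def)
    then show "\<exists>u \<in> verts (G X). \<exists>v \<in> verts (G X). u \<noteq> v \<and> e = {u, v}"
      unfolding K_nat_def complete_graph_def G_def by simp blast
  qed
  then have "subgraph (G X) K_nat"
    using X(1) RB by (auto simp: subgraph_def G_def K_nat_def complete_graph_def)
  moreover have "monochromatic R B (G X)"
    using X(1) by (auto simp: monochromatic_def G_def)
  moreover have "connected_graph (G X)"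
    by (rule connected_graph_if_inf_many_initial[OF _ X(2)]) (simp add: G_def)
  moreover have "strong_upper_density (G X) = 1"
    by (rule strong_upper_density_eq_1[OF _ X(2)]) (simp add: G_def)
  ultimately show ?thesis
    by blast
qed

end
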